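(* Let $\mathcal{M}$ be a Riemannian homogeneous space with symmetry group $G = I(\mathcal{M})$. Let $S$ and $U$ be $L^2(\mathcal{M},\mathbf{R})$ or $L^2(G,\mathbf{R})$, and let $F : S \to U$ be a function given by the Volterra expansion $$f \mapsto \sum_{n=1}^{\infty} (f \star_n w_n).$$ Then $F$ is equivariant, i.e. $F(g\cdot f) = g\cdot F(f)$ for all $g\in G$ and $f\in S$.
   Context: Standing assumptions: $\mathcal{M}$ is a Riemannian manifold on which its isometry group $G = I(\mathcal{M})$ acts transitively (a Riemannian homogeneous space); $G$ is a locally compact topological group. $\omega^{\mathcal{M}}$ is a suitable volume form on $\mathcal{M}$; no specific volume form is prescribed, and it is allowed to be arbitrary. $\mu_G$ is the Haar measure on $G$, invariant under translations: $\mu_G(gA)=\mu_G(A)$ for $g\in G$ and measurable $A\subset G$. $L^2(\mathcal{M},\mathbf{R})$ and $L^2(G,\mathbf{R})$ are the spaces of real-valued square-integrable functions on $\mathcal{M}$ and $G$. Action on functions: for $X = \mathcal{M}$ or $X = G$ (with $G$ acting on itself by left multiplication), $g\in G$ and $h : X \to \mathbf{R}$, $(g\cdot h)(x) = h(g^{-1}\cdot x)$; for $w : X^n \to \mathbf{R}$, $(g\cdot w)(x_1,\dots,x_n) = w(g^{-1}\cdot x_1,\dots,g^{-1}\cdot x_n)$. $n$-th order correlation (the kernels $w_n$ are real-valued functions on the $n$-fold product of the space on which $f$ is defined): for $f:\mathcal{M}\to\mathbf{R}$ and $w_n:\mathcal{M}^n\to\mathbf{R}$, $f\star_n w_n : G\to\mathbf{R}$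 is $$(f\star_n w_n)(g) = \int_{\mathcal{M}}\cdots\int_{\mathcal{M}} f(x_1)\cdots f(x_n)\,(g\cdot w_n)(x_1,\dots,x_n)\,\omega^{\mathcal{M}}(x_1)\cdots\omega^{\mathcal{M}}(x_n),$$ and for $f : G\to\mathbf{R}$ and $w_n : G^n\to\mathbf{R}$, $f\star_n w_n : G\to\mathbf{R}$ is $$(f\star_n w_n)(g) = \int_{G}\cdots\int_{G} f(h_1)\cdots f(h_n)\,(g\cdot w_n)(h_1,\dots,h_n)\,\mu_G(h_1)\cdots\mu_G(h_n).$$
   Formalization: For S = L^2(M,R), the measure of the volume form is additionally assumed invariant under G; for an arbitrary volume form the claim fails (e.g. M = R with a non-constant density). For S = L^2(G,R) the volume form stays arbitrary. *)

theory Defs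
  imports "HOL-Analysis.Analysis"
begin

section \<open>Smooth maps between Euclidean spaces\<close>

primrec Ck_on :: "nat \<Rightarrow> ('a::real_normed_vector \<Rightarrow> 'b::real_normed_vector) \<Rightarrow> 'a set \<Rightarrow> bool" where
  "Ck_on 0 f S \<longleftrightarrow> continuous_on S f"
| "Ck_on (Suc k) f S \<longleftrightarrow>
     (\<forall>x\<in>S. f differentiable (at x)) \<and> (\<forall>v. Ck_on k (\<lambda>x. frechet_derivative f (at x) v) S)"

text \<open>Meant for open \<open>S\<close>, since the derivatives are taken in the whole space.\<close>

definition smooth_on :: "'a::real_normed_vector set \<Rightarrow> ('a \<Rightarrow> 'b::real_normed_vector) \<Rightarrow> bool" where
  "smooth_on S f \<longleftrightarrow> (\<forall>k. Ck_on k f S)"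


section \<open>Riemannian manifolds\<close>

text \<open>
  A manifold is a whole type, which carries its (Hausdorff, second countable) topology through
  its type classes, together with an atlas. A chart is a pair of its domain and its coordinate map.
\<close>

type_synonym ('m, 'n) chart = "'m set \<times> ('m \<Rightarrow> real ^ 'n)"

definition chart_inv :: "('m, 'n::finite) chart \<Rightarrow> real ^ 'n \<Rightarrow> 'm" where
  "chart_inv c = inv_into (fst c) (snd c)"

definition is_chart :: "('m::topological_space, 'n::finite) chart \<Rightarrow> bool" where
  "is_chart c \<longleftrightarrow> open (fst c) \<and> open (snd c ` fst c) \<and>
     homeomorphism (fst c) (snd c ` fst c) (snd c) (chart_inv c)"

definition local_rep ::
  "('m \<Rightarrow> 'm) \<Rightarrow> ('m, 'n::finite) chart \<Rightarrow> ('m, 'n) chart \<Rightarrow> real ^ 'n \<Rightarrow> real ^ 'n" where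
  "local_rep \<phi> c d = snd d \<circ> \<phi> \<circ> chart_inv c"

definition local_deriv ::
  "('m \<Rightarrow> 'm) \<Rightarrow> ('m, 'n::finite) chart \<Rightarrow> ('m, 'n) chart \<Rightarrow> 'm \<Rightarrow> real ^ 'n \<Rightarrow> real ^ 'n" where
  "local_deriv \<phi> c d p = frechet_derivative (local_rep \<phi> c d) (at (snd c p))"

definition smooth_atlas :: "('m::topological_space, 'n::finite) chart set \<Rightarrow> bool" where
  "smooth_atlas A \<longleftrightarrow> (\<forall>c\<in>A. is_chart c) \<and> (\<Union>c\<in>A. fst c) = UNIV \<and>
     (\<forall>c\<in>A. \<forall>d\<in>A. smooth_on (snd c ` (fst c \<inter> fst d)) (local_rep id c d))"

definition smooth_map ::
  "('m::topological_space, 'n::finite) chart set \<Rightarrow> ('m \<Rightarrow> 'm) \<Rightarrow> bool" where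
  "smooth_map A \<phi> \<longleftrightarrow> continuous_on UNIV \<phi> \<and>
     (\<forall>c\<in>A. \<forall>d\<in>A. smooth_on (snd c ` (fst c \<inter> \<phi> -` fst d)) (local_rep \<phi> c d))"

text \<open>
  \<open>g c p\<close> is the inner product on the tangent space at \<open>p\<close>, expressed in the coordinates of
  the chart \<open>c\<close>; the last clause is the transformation law under a change of charts.
\<close>

type_synonym ('m, 'n) metric = "('m, 'n) chart \<Rightarrow> 'm \<Rightarrow> real ^ 'n \<Rightarrow> real ^ 'n \<Rightarrow> real"

definition riemannian_metric ::
  "('m::topological_space, 'n::finite) chart set \<Rightarrow> ('m, 'n) metric \<Rightarrow> bool" where
  "riemannian_metric A g \<longleftrightarrow>
     (\<forall>c\<in>A. \<forall>p\<in>fst c. bilinear (g c p) \<and> (\<forall>u v. g c p u v = g c p v u) \<and>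
        (\<forall>v. v \<noteq> 0 \<longrightarrow> 0 < g c p v v)) \<and>
     (\<forall>c\<in>A. \<forall>u v. smooth_on (snd c ` fst c) (\<lambda>x. g c (chart_inv c x) u v)) \<and>
     (\<forall>c\<in>A. \<forall>d\<in>A. \<forall>p\<in>fst c \<inter> fst d. \<forall>u v.
        g c p u v = g d p (local_deriv id c d p u) (local_deriv id c d p v))"

definition isometry_group ::
  "('m::topological_space, 'n::finite) chart set \<Rightarrow> ('m, 'n) metric \<Rightarrow> ('m \<Rightarrow> 'm) set" where
  "isometry_group A g =
     {\<phi>. bij \<phi> \<and> smooth_map A \<phi> \<and> smooth_map A (inv \<phi>) \<and>
        (\<forall>c\<in>A. \<forall>d\<in>A. \<forall>p\<in>fst c \<inter> \<phi> -` fst d. \<forall>u v.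
           g c p u v = g d (\<phi> p) (local_deriv \<phi> c d p u) (local_deriv \<phi> c d p v))}"

definition riemannian_homogeneous_space ::
  "('m::topological_space, 'n::finite) chart set \<Rightarrow> ('m, 'n) metric \<Rightarrow> bool" where
  "riemannian_homogeneous_space A g \<longleftrightarrow> smooth_atlas A \<and> riemannian_metric A g \<and>
     (\<forall>p q. \<exists>\<phi>\<in>isometry_group A g. \<phi> p = q)"

text \<open>
  \<open>\<omega> c\<close> is the coefficient of the form in the chart \<open>c\<close>: on the domain of \<open>c\<close> the form is
  \<open>\<omega> c\<close> times the wedge product of the coordinate differentials of \<open>c\<close> in their order.
\<close>

definition volume_form ::
  "('m::topological_space, 'n::finite) chart set \<Rightarrow> (('m, 'n) chart \<Rightarrow> 'm \<Rightarrow> real) \<Rightarrow> bool" where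
  "volume_form A \<omega> \<longleftrightarrow>
     (\<forall>c\<in>A. (\<forall>p\<in>fst c. \<omega> c p \<noteq> 0) \<and> smooth_on (snd c ` fst c) (\<lambda>x. \<omega> c (chart_inv c x))) \<and>
     (\<forall>c\<in>A. \<forall>d\<in>A. \<forall>p\<in>fst c \<inter> fst d. \<omega> c p = det (matrix (local_deriv id c d p)) * \<omega> d p)"

text \<open>
  Integration of functions against \<open>\<omega>\<close>, with the manifold oriented by \<open>\<omega>\<close>, is integration
  against the measure \<open>\<nu>\<close> that \<open>volume_form_measure A \<omega> \<nu>\<close> determines.
\<close>

definition volume_form_measure ::
  "('m::topological_space, 'n::finite) chart set \<Rightarrow> (('m, 'n) chart \<Rightarrow> 'm \<Rightarrow> real) \<Rightarrow>
     'm measure \<Rightarrow> bool" where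
  "volume_form_measure A \<omega> \<nu> \<longleftrightarrow> sets \<nu> = sets borel \<and>
     (\<forall>c\<in>A. \<forall>B\<in>sets borel. B \<subseteq> fst c \<longrightarrow>
        emeasure \<nu> B = (\<integral>\<^sup>+ x\<in>snd c ` B. ennreal \<bar>\<omega> c (chart_inv c x)\<bar> \<partial>lborel))"


section \<open>Groups of transformations\<close>

definition compact_open_topology :: "('m::topological_space \<Rightarrow> 'm) set \<Rightarrow> ('m \<Rightarrow> 'm) topology" where
  "compact_open_topology G =
     topology_generated_by {{\<phi>\<in>G. \<phi> ` K \<subseteq> V} | K V. compact K \<and> open V}"

text \<open>The group operations are composition and inversion of maps.\<close>

definition locally_compact_topological_group :: "('m::topological_space \<Rightarrow> 'm) set \<Rightarrow> bool" where
  "locally_compact_topological_group G \<longleftrightarrow>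
     (let T = compact_open_topology G in
        locally_compact_space T \<and>
        continuous_map (prod_topology T T) T (\<lambda>(a, b). a \<circ> b) \<and>
        continuous_map T T (\<lambda>a. inv a))"

definition haar_measure :: "('m::topological_space \<Rightarrow> 'm) set \<Rightarrow> ('m \<Rightarrow> 'm) measure \<Rightarrow> bool" where
  "haar_measure G \<mu> \<longleftrightarrow>
     (let T = compact_open_topology G in
        space \<mu> = G \<and> sets \<mu> = sigma_sets G {V. openin T V} \<and> emeasure \<mu> G \<noteq> 0 \<and>
        (\<forall>K. compactin T K \<longrightarrow> emeasure \<mu> K < \<infinity>) \<and>
        (\<forall>B\<in>sets \<mu>. emeasure \<mu> B = (INF V\<in>{V. openin T V \<and> B \<subseteq> V}. emeasure \<mu> V)) \<and>
        (\<forall>V. openin T V \<longrightarrow> emeasure \<mu> V = (SUP K\<in>{K. compactin T K \<and> K \<subseteq> V}. emeasure \<mu> K)) \<and>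
        (\<forall>a\<in>G. \<forall>B\<in>sets \<mu>. emeasure \<mu> ((\<lambda>h. a \<circ> h) ` B) = emeasure \<mu> B))"

text \<open>
  Isometries may reverse the orientation, so a volume form can at best be invariant up to sign;
  its measure does not see the sign.
\<close>

definition invariant_measure :: "('m \<Rightarrow> 'm) set \<Rightarrow> 'm measure \<Rightarrow> bool" where
  "invariant_measure G \<nu> \<longleftrightarrow> (\<forall>a\<in>G. \<forall>B\<in>sets \<nu>. emeasure \<nu> (a ` B) = emeasure \<nu> B)"


section \<open>Square-integrable functions\<close>

definition L2_functions :: "'x measure \<Rightarrow> ('x \<Rightarrow> real) set" where
  "L2_functions \<nu> = {f \<in> borel_measurable \<nu>. integrable \<nu> (\<lambda>x. (f x)\<^sup>2)}"

definition L2_eq :: "'x measure \<Rightarrow> (('x \<Rightarrow> real) \<times> ('x \<Rightarrow> real)) set" where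
  "L2_eq \<nu> = {(f, h). f \<in> L2_functions \<nu> \<and> h \<in> L2_functions \<nu> \<and> (AE x in \<nu>. f x = h x)}"

definition L2 :: "'x measure \<Rightarrow> ('x \<Rightarrow> real) set set" where
  "L2 \<nu> = L2_functions \<nu> // L2_eq \<nu>"

text \<open>The sum of a series of functions is taken pointwise almost everywhere or in the \<open>L\<^sup>2\<close> norm.\<close>

datatype convergence_mode = Almost_Everywhere | Mean_Square

definition series_sums ::
  "convergence_mode \<Rightarrow> 'x measure \<Rightarrow> (nat \<Rightarrow> 'x \<Rightarrow> real) \<Rightarrow> ('x \<Rightarrow> real) \<Rightarrow> bool" where
  "series_sums mode \<nu> t u \<longleftrightarrow>
     (case mode of
        Almost_Everywhere \<Rightarrow> AE x in \<nu>. (\<lambda>n. t n x) sums u x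
      | Mean_Square \<Rightarrow> (\<forall>n. t n \<in> L2_functions \<nu>) \<and> u \<in> L2_functions \<nu> \<and>
          (\<lambda>N. \<integral>x. ((\<Sum>n<N. t n x) - u x)\<^sup>2 \<partial>\<nu>) \<longlonglongrightarrow> 0)"


section \<open>Correlations, Volterra expansions and equivariance\<close>

text \<open>
  In the following, \<open>act\<close> is the action of the group on the space \<open>X\<close> at hand: \<open>act a x = a x\<close>
  on the manifold and \<open>act a h = a \<circ> h\<close> on the group. Elements of the \<open>n\<close>-fold product of \<open>X\<close>
  are lists of length \<open>n\<close>.
\<close>

definition translate ::
  "(('m \<Rightarrow> 'm) \<Rightarrow> 'x \<Rightarrow> 'x) \<Rightarrow> ('m \<Rightarrow> 'm) \<Rightarrow> ('x \<Rightarrow> real) \<Rightarrow> ('x \<Rightarrow> real)" where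
  "translate act a f = (\<lambda>x. f (act (inv a) x))"

definition translate_kernel ::
  "(('m \<Rightarrow> 'm) \<Rightarrow> 'x \<Rightarrow> 'x) \<Rightarrow> ('m \<Rightarrow> 'm) \<Rightarrow> ('x list \<Rightarrow> real) \<Rightarrow> ('x list \<Rightarrow> real)" where
  "translate_kernel act a w = (\<lambda>xs. w (map (act (inv a)) xs))"

primrec iterated_integral :: "'x measure \<Rightarrow> nat \<Rightarrow> ('x list \<Rightarrow> real) \<Rightarrow> real" where
  "iterated_integral \<nu> 0 \<Phi> = \<Phi> []"
| "iterated_integral \<nu> (Suc n) \<Phi> = (\<integral>x. iterated_integral \<nu> n (\<lambda>xs. \<Phi> (x # xs)) \<partial>\<nu>)"

definition correlation ::
  "(('m \<Rightarrow> 'm) \<Rightarrow> 'x \<Rightarrow> 'x) \<Rightarrow> 'x measure \<Rightarrow> nat \<Rightarrow> ('x \<Rightarrow> real) \<Rightarrow> ('x list \<Rightarrow> real) \<Rightarrow>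
     ('m \<Rightarrow> 'm) \<Rightarrow> real" where
  "correlation act \<nu> n f w a =
     iterated_integral \<nu> n (\<lambda>xs. prod_list (map f xs) * translate_kernel act a w xs)"

text \<open>
  Correlations are functions on the group \<open>G\<close>, whereas the values of \<open>F\<close> are functions on \<open>Y\<close>,
  which is \<open>G\<close> (with \<open>\<pi> h = h\<close>) or the manifold (with the orbit map \<open>\<pi> h = h x0\<close> of a base
  point \<open>x0\<close>, which identifies the manifold with the quotient of \<open>G\<close> by the stabilizer of \<open>x0\<close>).
  In the latter case, the correlations have to descend along \<open>\<pi>\<close> to functions \<open>t n\<close> on the
  manifold. The kernel of order \<open>n\<close> is \<open>w n\<close>, and \<open>w 0\<close> is not used.
\<close>

definition volterra_expansion ::
  "convergence_mode \<Rightarrow> ('m \<Rightarrow> 'm) set \<Rightarrow> (('m \<Rightarrow> 'm) \<Rightarrow> 'x \<Rightarrow> 'x) \<Rightarrow> 'x measure \<Rightarrow>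
     (('m \<Rightarrow> 'm) \<Rightarrow> 'y) \<Rightarrow> 'y measure \<Rightarrow> (nat \<Rightarrow> 'x list \<Rightarrow> real) \<Rightarrow>
     (('x \<Rightarrow> real) set \<Rightarrow> ('y \<Rightarrow> real) set) \<Rightarrow> bool" where
  "volterra_expansion mode G act \<nu> \<pi> \<kappa> w F \<longleftrightarrow>
     (\<forall>C\<in>L2 \<nu>. F C \<in> L2 \<kappa> \<and>
        (\<forall>f\<in>C. \<forall>u\<in>F C. \<exists>t.
           (\<forall>n\<ge>1. \<forall>h\<in>G. t n (\<pi> h) = correlation act \<nu> n f (w n) h) \<and>
           series_sums mode \<kappa> (\<lambda>n. t (Suc n)) u))"

text \<open>The group acts on \<open>L\<^sup>2\<close> classes by translating all representatives.\<close>

definition equivariant ::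
  "('m \<Rightarrow> 'm) set \<Rightarrow> (('m \<Rightarrow> 'm) \<Rightarrow> 'x \<Rightarrow> 'x) \<Rightarrow> 'x measure \<Rightarrow> (('m \<Rightarrow> 'm) \<Rightarrow> 'y \<Rightarrow> 'y) \<Rightarrow>
     (('x \<Rightarrow> real) set \<Rightarrow> ('y \<Rightarrow> real) set) \<Rightarrow> bool" where
  "equivariant G act \<nu> act' F \<longleftrightarrow>
     (\<forall>a\<in>G. \<forall>C\<in>L2 \<nu>. F (translate act a ` C) = translate act' a ` F C)"

definition act_manifold :: "('m \<Rightarrow> 'm) \<Rightarrow> 'm \<Rightarrow> 'm" where
  "act_manifold a x = a x"

definition act_group :: "('m \<Rightarrow> 'm) \<Rightarrow> ('m \<Rightarrow> 'm) \<Rightarrow> ('m \<Rightarrow> 'm)" where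
  "act_group a h = a \<circ> h"

definition orbit_map :: "'m \<Rightarrow> ('m \<Rightarrow> 'm) \<Rightarrow> 'm" where
  "orbit_map x0 h = h x0"

end

theory Submission
  imports Defs
begin

text \<open>
  Substituting \<open>x\<^sub>i = a y\<^sub>i\<close> in the iterated integral, which the invariance of the measure on the
  source allows, gives \<open>(a \<cdot> f) \<star>\<^sub>n w = a \<cdot> (f \<star>\<^sub>n w)\<close> for every order \<open>n\<close>. To pass to
  the sum of the series, the measure on the target need not be invariant: almost everywhere
  convergence is translated as soon as null sets are, and mean square convergence yields almost
  everywhere convergence of a subsequence. The measure of an arbitrary volume form has this
  property, since diffeomorphisms map Lebesgue null sets to Lebesgue null sets.
\<close>

section \<open>Square-integrable functions\<close>

text \<open>\<open>M\<close> may be incomplete, so almost everywhere equality alone does not make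
  \<open>h\<close> measurable; this is a separate assumption.\<close>

lemma L2_functions_AE_cong:
  assumes "f \<in> L2_functions M" "h \<in> borel_measurable M" "AE x in M. h x = f x"
  shows "h \<in> L2_functions M"
proof -
  have f: "f \<in> borel_measurable M" "integrable M (\<lambda>x. (f x)\<^sup>2)"
    using assms(1) by (auto simp: L2_functions_def)
  have "integrable M (\<lambda>x. (h x)\<^sup>2) \<longleftrightarrow> integrable M (\<lambda>x. (f x)\<^sup>2)"
    by (rule integrable_cong_AE) (use f assms in auto)
  then show ?thesis
    using f assms by (simp add: L2_functions_def)
qed

lemma L2_functions_add:
  assumes "f \<in> L2_functions M" "h \<in> L2_functions M"
  shows "(\<lambda>x. f x + h x) \<in> L2_functions M"
proof -
  have [measurable]: "f \<in> borel_measurable M" "h \<in> borel_measurable M"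
    and int: "integrable M (\<lambda>x. (f x)\<^sup>2)" "integrable M (\<lambda>x. (h x)\<^sup>2)"
    using assms by (auto simp: L2_functions_def)
  have "integrable M (\<lambda>x. (f x + h x)\<^sup>2)"
  proof (rule Bochner_Integration.integrable_bound)
    show "integrable M (\<lambda>x. 2 * (f x)\<^sup>2 + 2 * (h x)\<^sup>2)"
      using int by simp
    have "(f x + h x)\<^sup>2 \<le> 2 * (f x)\<^sup>2 + 2 * (h x)\<^sup>2" for x
      using zero_le_power2[of "f x - h x"] by (simp add: power2_eq_square algebra_simps)
    then show "AE x in M. norm ((f x + h x)\<^sup>2) \<le> norm (2 * (f x)\<^sup>2 + 2 * (h x)\<^sup>2)"
      by simp
  qed simp
  then show ?thesis
    by (simp add: L2_functions_def)
qed

lemma L2_functions_uminus: "f \<in> L2_functions M \<Longrightarrow> (\<lambda>x. - f x) \<in> L2_functions M"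
  by (auto simp: L2_functions_def)

lemma L2_functions_diff:
  assumes "f \<in> L2_functions M" "h \<in> L2_functions M"
  shows "(\<lambda>x. f x - h x) \<in> L2_functions M"
  using L2_functions_add[OF assms(1) L2_functions_uminus[OF assms(2)]] by simp

lemma L2_functions_sum:
  assumes "\<And>i. t i \<in> L2_functions M"
  shows "(\<lambda>x. \<Sum>i<(N::nat). t i x) \<in> L2_functions M"
proof (induction N)
  case 0
  show ?case by (simp add: L2_functions_def)
next
  case (Suc N)
  show ?case using L2_functions_add[OF Suc assms[of N]] by simp
qed

section \<open>Classes modulo almost everywhere equality\<close>

lemma equiv_L2_eq: "equiv (L2_functions M) (L2_eq M)"
proof (intro equivI refl_onI symI transI)
  fix f h k assume "(f, h) \<in> L2_eq M" "(h, k) \<in> L2_eq M"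
  then show "(f, k) \<in> L2_eq M"
    by (auto simp: L2_eq_def)
qed (auto simp: L2_eq_def)

lemma L2_class_subset: "C \<in> L2 M \<Longrightarrow> f \<in> C \<Longrightarrow> f \<in> L2_functions M"
  using equiv_L2_eq in_quotient_imp_subset unfolding L2_def by blast

lemma L2_class_nonempty: "C \<in> L2 M \<Longrightarrow> \<exists>f. f \<in> C"
  using equiv_L2_eq in_quotient_imp_non_empty unfolding L2_def by blast

lemma L2_class_eq:
  assumes "C \<in> L2 M" "f \<in> C"
  shows "C = L2_eq M `` {f}"
proof -
  obtain k where k: "C = L2_eq M `` {k}"
    using assms unfolding L2_def by (auto elim: quotientE)
  with assms(2) have "(k, f) \<in> L2_eq M"
    by simp
  with k show ?thesis
    using equiv_class_eq[OF equiv_L2_eq] by blast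
qed

lemma L2_class_in: "f \<in> L2_functions M \<Longrightarrow> L2_eq M `` {f} \<in> L2 M"
  unfolding L2_def by (rule quotientI)

text \<open>Both modes give almost everywhere convergence of the partial sums after thinning out:
  the first along \<open>r\<close> itself, the second because the squared errors tend to 0 in mean
  and hence almost everywhere along a subsequence. The prescribed \<open>r\<close> permits
  successive extractions, so that two series can share one subsequence.\<close>

lemma series_sums_subseq:
  assumes "series_sums mode M t u" "strict_mono (r :: nat \<Rightarrow> nat)"
  obtains s where "strict_mono (s :: nat \<Rightarrow> nat)"
    "AE x in M. (\<lambda>N. \<Sum>n<r (s N). t n x) \<longlonglongrightarrow> u x"
proof (cases mode)
  case Almost_Everywhere
  then have "AE x in M. (\<lambda>N. \<Sum>n<N. t n x) \<longlonglongrightarrow> u x"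
    using assms(1) by (simp add: series_sums_def sums_def)
  then have "AE x in M. (\<lambda>N. \<Sum>n<r (id N). t n x) \<longlonglongrightarrow> u x"
    by eventually_elim (use LIMSEQ_subseq_LIMSEQ[OF _ assms(2)] in \<open>auto simp: comp_def\<close>)
  then show ?thesis
    by (rule that[rotated]) (simp add: strict_mono_def)
next
  case Mean_Square
  then have t: "\<And>n. t n \<in> L2_functions M" "u \<in> L2_functions M"
    and lim: "(\<lambda>N. \<integral>x. ((\<Sum>n<N. t n x) - u x)\<^sup>2 \<partial>M) \<longlonglongrightarrow> 0"
    using assms by (auto simp: series_sums_def)
  have "(\<lambda>x. (\<Sum>n<N. t n x) - u x) \<in> L2_functions M" for N
    by (intro L2_functions_diff L2_functions_sum t)
  then have "integrable M (\<lambda>x. ((\<Sum>n<r N. t n x) - u x)\<^sup>2)" for N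
    by (simp add: L2_functions_def)
  moreover have "(\<lambda>N. \<integral>x. ((\<Sum>n<r N. t n x) - u x)\<^sup>2 \<partial>M) \<longlonglongrightarrow> 0"
    using LIMSEQ_subseq_LIMSEQ[OF lim assms(2)] by (simp add: comp_def)
  ultimately obtain s where s: "strict_mono s"
      "AE x in M. (\<lambda>N. ((\<Sum>n<r (s N). t n x) - u x)\<^sup>2) \<longlonglongrightarrow> 0"
    using tendsto_L1_AE_subseq[of M "\<lambda>N x. ((\<Sum>n<r N. t n x) - u x)\<^sup>2"] by auto
  from s(2) have "AE x in M. (\<lambda>N. \<Sum>n<r (s N). t n x) \<longlonglongrightarrow> u x"
  proof eventually_elim
    case (elim x)
    from tendsto_real_sqrt[OF elim] have "(\<lambda>N. \<bar>(\<Sum>n<r (s N). t n x) - u x\<bar>) \<longlonglongrightarrow> 0"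
      by simp
    then show ?case
      by (simp add: tendsto_rabs_zero_iff LIM_zero_iff)
  qed
  with s(1) show ?thesis by (rule that)
qed

section \<open>Group actions on measure spaces\<close>

text \<open>Only null sets are respected, which is what the measure of an arbitrary volume form
  offers on the target. The laws \<open>act_comp\<close> and \<open>act_id\<close> range over all
  maps because evaluation and composition obey them for every map, not only on
  \<open>G\<close>.\<close>

locale nonsingular_action =
  fixes G :: "('m \<Rightarrow> 'm) set" and act :: "('m \<Rightarrow> 'm) \<Rightarrow> 'x \<Rightarrow> 'x" and M :: "'x measure"
  assumes bij: "a \<in> G \<Longrightarrow> bij a"
    and inv_closed: "a \<in> G \<Longrightarrow> inv a \<in> G"
    and comp_closed: "a \<in> G \<Longrightarrow> b \<in> G \<Longrightarrow> a \<circ> b \<in> G"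
    and act_comp: "act (a \<circ> b) x = act a (act b x)"
    and act_id: "act id x = x"
    and act_measurable: "a \<in> G \<Longrightarrow> act a \<in> measurable M M"
    and act_null_sets: "a \<in> G \<Longrightarrow> N \<in> null_sets M \<Longrightarrow> act a -` N \<inter> space M \<in> null_sets M"
begin

lemma inv_inv: "a \<in> G \<Longrightarrow> inv (inv a) = a"
  by (simp add: bij inv_inv_eq)

lemma act_inv [simp]: "a \<in> G \<Longrightarrow> act (inv a) (act a x) = x" "a \<in> G \<Longrightarrow> act a (act (inv a) x) = x"
  by (metis act_comp act_id bij bij_is_inj inv_o_cancel)
     (metis act_comp act_id bij bij_is_surj surj_iff)

lemma AE_act:
  assumes "a \<in> G" "AE x in M. P x"
  shows "AE x in M. P (act a x)"
proof -
  obtain N where N: "{x \<in> space M. \<not> P x} \<subseteq> N" "N \<in> null_sets M"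
    using assms(2) by (auto elim: AE_E3 simp: eventually_ae_filter)
  show ?thesis
  proof (rule AE_I')
    show "act a -` N \<inter> space M \<in> null_sets M"
      using act_null_sets assms(1) N(2) .
    show "{x \<in> space M. \<not> P (act a x)} \<subseteq> act a -` N \<inter> space M"
      using N(1) measurable_space[OF act_measurable[OF assms(1)]] by auto
  qed
qed

lemma translate_measurable:
  "a \<in> G \<Longrightarrow> f \<in> borel_measurable M \<Longrightarrow> translate act a f \<in> borel_measurable M"
  unfolding translate_def by (rule measurable_compose[OF act_measurable[OF inv_closed]])

lemma AE_translate:
  "a \<in> G \<Longrightarrow> AE x in M. f x = h x \<Longrightarrow> AE x in M. translate act a f x = translate act a h x"
  unfolding translate_def by (rule AE_act[OF inv_closed])

lemma translate_inverse:
  "a \<in> G \<Longrightarrow> translate act a (translate act (inv a) f) = f"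
  "a \<in> G \<Longrightarrow> translate act (inv a) (translate act a f) = f"
  by (simp_all add: translate_def inv_inv)

text \<open>The translate of a square-integrable function need not be square-integrable here.\<close>

lemma translate_class:
  assumes a: "a \<in> G" and f: "f \<in> L2_functions M" and af: "translate act a f \<in> L2_functions M"
  shows "translate act a ` (L2_eq M `` {f}) = L2_eq M `` {translate act a f}"
proof (intro equalityI subsetI)
  fix v' assume "v' \<in> translate act a ` (L2_eq M `` {f})"
  then obtain v where v: "v' = translate act a v" "v \<in> L2_functions M" "AE x in M. f x = v x"
    by (auto simp: L2_eq_def)
  have ae: "AE x in M. translate act a f x = v' x"
    unfolding v(1) by (rule AE_translate[OF a v(3)])
  moreover have "v' \<in> L2_functions M"
  proof (rule L2_functions_AE_cong[OF af])
    show "v' \<in> borel_measurable M"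
      using v(1,2) translate_measurable[OF a] by (simp add: L2_functions_def)
    show "AE x in M. v' x = translate act a f x"
      using ae by eventually_elim simp
  qed
  ultimately show "v' \<in> L2_eq M `` {translate act a f}"
    using af by (simp add: L2_eq_def)
next
  fix v' assume "v' \<in> L2_eq M `` {translate act a f}"
  then have v': "v' \<in> L2_functions M" "AE x in M. translate act a f x = v' x"
    by (auto simp: L2_eq_def)
  \<comment> \<open>Translating back gives the preimage of \<open>v'\<close>. It is
    square-integrable because it agrees almost everywhere with \<open>f\<close>; translation by
    \<open>inv a\<close> does not guarantee this.\<close>
  define v where "v = translate act (inv a) v'"
  have ae: "AE x in M. f x = v x"
    using AE_translate[OF inv_closed[OF a] v'(2)] by (simp add: v_def translate_inverse a)
  have "v \<in> L2_functions M"
  proof (rule L2_functions_AE_cong[OF f])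
    show "v \<in> borel_measurable M"
      using v'(1) translate_measurable[OF inv_closed[OF a]] by (simp add: v_def L2_functions_def)
    show "AE x in M. v x = f x"
      using ae by eventually_elim simp
  qed
  with ae f have "v \<in> L2_eq M `` {f}"
    by (simp add: L2_eq_def)
  moreover have "v' = translate act a v"
    by (simp add: v_def translate_inverse a)
  ultimately show "v' \<in> translate act a ` (L2_eq M `` {f})"
    by blast
qed

text \<open>Extract a subsequence \<open>r\<close> for \<open>t\<close>, then a further one for
  \<open>t'\<close>. Pulling the first convergence back along \<open>act (inv a)\<close> costs only
  a null set, and at almost every point the same partial sums then have both limits.\<close>

lemma series_sums_translate:
  assumes a: "a \<in> G" and sums: "series_sums mode M t u" and sums': "series_sums mode M t' u'"
    and t': "\<And>n x. x \<in> space M \<Longrightarrow> t' n x = translate act a (t n) x"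
  shows "AE x in M. u' x = translate act a u x"
proof -
  obtain r where r: "strict_mono r" "AE x in M. (\<lambda>N. \<Sum>n<r N. t n x) \<longlonglongrightarrow> u x"
    using series_sums_subseq[OF sums strict_mono_id] by auto
  obtain s where s: "strict_mono s" "AE x in M. (\<lambda>N. \<Sum>n<r (s N). t' n x) \<longlonglongrightarrow> u' x"
    using series_sums_subseq[OF sums' r(1)] by auto
  from AE_act[OF inv_closed[OF a] r(2)] s(2) AE_space show ?thesis
  proof eventually_elim
    case (elim x)
    have "(\<lambda>N. \<Sum>n<r (s N). t n (act (inv a) x)) \<longlonglongrightarrow> u (act (inv a) x)"
      using LIMSEQ_subseq_LIMSEQ[OF elim(1) s(1)] by (simp add: comp_def)
    with elim(2,3) show ?case
      by (auto simp: t' translate_def intro: LIMSEQ_unique)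
  qed
qed

end

section \<open>Change of variables and the equivariance argument\<close>

locale measure_preserving_action = nonsingular_action +
  assumes distr_act: "a \<in> G \<Longrightarrow> distr M M (act a) = M"
begin

lemma integral_act:
  fixes f :: "_ \<Rightarrow> 'e::{banach, second_countable_topology}"
  assumes "a \<in> G"
  shows "(\<integral>x. f (act a x) \<partial>M) = (\<integral>x. f x \<partial>M)"
proof (cases "f \<in> borel_measurable M")
  case True
  then show ?thesis
    using integral_distr[OF act_measurable[OF assms], of f] by (simp add: distr_act assms)
next
  case False
  \<comment> \<open>Composing with \<open>act (inv a)\<close> would recover \<open>f\<close>, so
    both integrands are non-measurable and both integrals take the default value 0. This case
    matters because kernels carry no measurability assumption.\<close>
  have "(\<lambda>x. f (act a x)) \<notin> borel_measurable M"
  proof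
    assume "(\<lambda>x. f (act a x)) \<in> borel_measurable M"
    from measurable_compose[OF act_measurable[OF inv_closed[OF assms]] this] False assms
    show False by simp
  qed
  with False show ?thesis
    by (metis borel_measurable_integrable not_integrable_integral_eq)
qed

text \<open>The variables are substituted one at a time: the inner ones by the induction hypothesis,
  for each fixed outer point, then the outer one by \<open>integral_act\<close>, whatever the
  measurability of the inner integral.\<close>

lemma iterated_integral_act:
  "a \<in> G \<Longrightarrow> iterated_integral M n (\<lambda>xs. \<Phi> (map (act a) xs)) = iterated_integral M n \<Phi>"
proof (induction n arbitrary: \<Phi>)
  case (Suc n)
  have "iterated_integral M (Suc n) (\<lambda>xs. \<Phi> (map (act a) xs)) =
      (\<integral>x. iterated_integral M n (\<lambda>xs. \<Phi> (act a x # xs)) \<partial>M)"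
    using Suc.IH[OF Suc.prems, of "\<lambda>xs. \<Phi> (act a _ # xs)"] by simp
  also have "\<dots> = iterated_integral M (Suc n) \<Phi>"
    using integral_act[OF Suc.prems, of "\<lambda>x. iterated_integral M n (\<lambda>xs. \<Phi> (x # xs))"] by simp
  finally show ?case .
qed simp

text \<open>Under \<open>x = a y\<close> in each variable, \<open>f (inv a x)\<close> becomes
  \<open>f y\<close>, and \<open>inv h x\<close> becomes \<open>inv h (a y)\<close>, where
  \<open>inv h \<circ> a\<close> is the inverse of \<open>inv a \<circ> h\<close>. The right-hand
  side is the translate by \<open>a\<close> of the correlation, evaluated at
  \<open>h\<close>.\<close>

lemma correlation_translate:
  assumes a: "a \<in> G" and h: "h \<in> G"
  shows "correlation act M n (translate act a f) w h = correlation act M n f w (inv a \<circ> h)"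
proof -
  let ?\<Phi> = "\<lambda>xs. prod_list (map (translate act a f) xs) * translate_kernel act h w xs"
  have inv: "inv (inv a \<circ> h) = inv h \<circ> a"
    using o_inv_distrib[OF bij[OF inv_closed[OF a]] bij[OF h]] by (simp add: inv_inv a)
  have act_inv_h: "act (inv h \<circ> a) = (\<lambda>x. act (inv h) (act a x))"
    by (simp add: fun_eq_iff act_comp)
  have "?\<Phi> (map (act a) xs) = prod_list (map f xs) * translate_kernel act (inv a \<circ> h) w xs" for xs
    by (simp add: translate_def translate_kernel_def o_def[of _ "act a"] inv act_inv_h a)
  then show ?thesis
    using iterated_integral_act[OF a, of n ?\<Phi>] by (simp add: correlation_def)
qed

lemma translate_L2_functions:
  assumes a: "a \<in> G" and f: "f \<in> L2_functions M"
  shows "translate act a f \<in> L2_functions M"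
proof -
  have "integrable M (\<lambda>x. (f (act (inv a) x))\<^sup>2)"
    using f integrable_distr[OF act_measurable[OF inv_closed[OF a]], of "\<lambda>x. (f x)\<^sup>2"]
    by (simp add: L2_functions_def distr_act inv_closed a)
  moreover have "translate act a f \<in> borel_measurable M"
    using f translate_measurable[OF a] by (simp add: L2_functions_def)
  ultimately show ?thesis
    by (simp add: L2_functions_def translate_def)
qed

text \<open>The locale is the source, \<open>\<kappa>\<close> the target. Since \<open>\<pi>\<close>
  intertwines the actions, the shift by \<open>inv a\<close> on the group becomes the action on the
  target; since \<open>\<pi>\<close> is onto, the correlations determine every term on all of
  \<open>space \<kappa>\<close>. Comparing one representative of \<open>F C\<close> with one of its
  counterpart then identifies the classes.\<close>

lemma volterra_expansion_equivariant:
  assumes target: "nonsingular_action G act' \<kappa>"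
    and \<pi>_act: "\<And>a h. \<pi> (a \<circ> h) = act' a (\<pi> h)"
    and \<pi>_onto: "space \<kappa> \<subseteq> \<pi> ` G"
    and volterra: "volterra_expansion mode G act M \<pi> \<kappa> w F"
  shows "equivariant G act M act' F"
  unfolding equivariant_def
proof (intro ballI)
  interpret target: nonsingular_action G act' \<kappa> by (rule target)
  fix a C assume a: "a \<in> G" and C: "C \<in> L2 M"
  obtain f where f: "f \<in> C"
    using L2_class_nonempty[OF C] by blast
  let ?f = "translate act a f" and ?C = "translate act a ` C"
  have f_L2: "f \<in> L2_functions M"
    using L2_class_subset[OF C f] .
  have "?C = L2_eq M `` {?f}"
    using L2_class_eq[OF C f] translate_class[OF a f_L2 translate_L2_functions[OF a f_L2]] by simp
  then have C': "?C \<in> L2 M"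
    using L2_class_in translate_L2_functions[OF a f_L2] by simp
  have FC: "F C \<in> L2 \<kappa>" and FC': "F ?C \<in> L2 \<kappa>"
    using volterra C C' by (auto simp: volterra_expansion_def)
  obtain u where u: "u \<in> F C"
    using L2_class_nonempty[OF FC] by blast
  obtain u' where u': "u' \<in> F ?C"
    using L2_class_nonempty[OF FC'] by blast
  have ex: "\<exists>t. (\<forall>n\<ge>1. \<forall>h\<in>G. t n (\<pi> h) = correlation act M n k (w n) h) \<and>
      series_sums mode \<kappa> (\<lambda>n. t (Suc n)) v" if "D \<in> L2 M" "k \<in> D" "v \<in> F D" for D k v
    using volterra that unfolding volterra_expansion_def by (elim ballE conjE) auto
  obtain t where t: "\<And>n h. n \<ge> 1 \<Longrightarrow> h \<in> G \<Longrightarrow> t n (\<pi> h) = correlation act M n f (w n) h"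
      "series_sums mode \<kappa> (\<lambda>n. t (Suc n)) u"
    using ex[OF C f u] by blast
  have "?f \<in> ?C"
    using f by simp
  then obtain t' where t': "\<And>n h. n \<ge> 1 \<Longrightarrow> h \<in> G \<Longrightarrow> t' n (\<pi> h) = correlation act M n ?f (w n) h"
      "series_sums mode \<kappa> (\<lambda>n. t' (Suc n)) u'"
    using ex[OF C' _ u'] by blast
  \<comment> \<open>At \<open>x = \<pi> h\<close> the translated term is the value of
    \<open>t (Suc n)\<close> at \<open>\<pi> (inv a \<circ> h)\<close>. The successor index matches
    a series that starts at order 1.\<close>
  have "t' (Suc n) x = translate act' a (t (Suc n)) x" if x: "x \<in> space \<kappa>" for n x
  proof -
    obtain h where h: "h \<in> G" "x = \<pi> h"
      using x \<pi>_onto by blast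
    have "t' (Suc n) x = t (Suc n) (\<pi> (inv a \<circ> h))"
      using h t(1) t'(1) a by (simp add: correlation_translate inv_closed comp_closed)
    then show ?thesis
      by (simp add: translate_def \<pi>_act h)
  qed
  then have ae: "AE x in \<kappa>. u' x = translate act' a u x"
    using target.series_sums_translate[OF a t(2) t'(2)] by blast
  have u_L2: "u \<in> L2_functions \<kappa>" and u'_L2: "u' \<in> L2_functions \<kappa>"
    using L2_class_subset FC u FC' u' by blast+
  \<comment> \<open>Square-integrability is borrowed from \<open>u'\<close>, as a nonsingular action
    on the target need not preserve it.\<close>
  have au_L2: "translate act' a u \<in> L2_functions \<kappa>"
  proof (rule L2_functions_AE_cong[OF u'_L2])
    show "translate act' a u \<in> borel_measurable \<kappa>"
      using u_L2 target.translate_measurable[OF a] by (simp add: L2_functions_def)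
    show "AE x in \<kappa>. translate act' a u x = u' x"
      using ae by eventually_elim simp
  qed
  have "F ?C = L2_eq \<kappa> `` {u'}"
    by (rule L2_class_eq[OF FC' u'])
  also have "\<dots> = L2_eq \<kappa> `` {translate act' a u}"
    by (rule equiv_class_eq[OF equiv_L2_eq]) (use ae u'_L2 au_L2 in \<open>simp add: L2_eq_def\<close>)
  also have "\<dots> = translate act' a ` F C"
    using L2_class_eq[OF FC u] target.translate_class[OF a u_L2 au_L2] by simp
  finally show "F ?C = translate act' a ` F C" .
qed

end

text \<open>Invariance is given for images, whereas the locale asks for preimages; the two are
  exchanged because the preimage of \<open>B\<close> under \<open>act a\<close> is its image under
  \<open>act (inv a)\<close>.\<close>

lemma measure_preserving_actionI:
  assumes "\<And>a. a \<in> G \<Longrightarrow> bij a" "\<And>a. a \<in> G \<Longrightarrow> inv a \<in> G" "\<And>a b. a \<in> G \<Longrightarrow> b \<in> G \<Longrightarrow> a \<circ> b \<in> G"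
    and act: "\<And>a b x. act (a \<circ> b) x = act a (act b x)" "\<And>x. act id x = x"
    and meas: "\<And>a. a \<in> G \<Longrightarrow> act a \<in> measurable M M"
    and emeasure: "\<And>a B. a \<in> G \<Longrightarrow> B \<in> sets M \<Longrightarrow> emeasure M (act a ` B) = emeasure M B"
  shows "measure_preserving_action G act M"
proof -
  have vimage: "act a -` B \<inter> space M = act (inv a) ` B" if "a \<in> G" "B \<in> sets M" for a B
  proof -
    have inv: "act (inv a) (act a x) = x" "act a (act (inv a) x) = x" for x
      using that(1) assms(1)
      by (metis act bij_is_inj inv_o_cancel, metis act assms(1) bij_is_surj surj_iff)
    \<comment> \<open>The space can be smaller than the type, as for the group, so the image must be
      shown to stay inside it.\<close>
    have "act (inv a) x \<in> space M" if "x \<in> B" for x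
      using measurable_space[OF meas[OF assms(2)[OF \<open>a \<in> G\<close>]]] sets.sets_into_space[OF \<open>B \<in> sets M\<close>] that
      by blast
    moreover have "x \<in> act (inv a) ` B" if "act a x \<in> B" for x
      using imageI[OF that, of "act (inv a)"] by (simp only: inv)
    ultimately show ?thesis
      by (auto simp only: inv)
  qed
  have eq: "emeasure M (act a -` B \<inter> space M) = emeasure M B" if "a \<in> G" "B \<in> sets M" for a B
    using vimage[OF that] emeasure[OF assms(2)[OF that(1)] that(2)] by simp
  show ?thesis
  proof
    fix a assume a: "a \<in> G"
    show "distr M M (act a) = M"
      by (rule measure_eqI) (use a meas eq in \<open>auto simp: emeasure_distr\<close>)
    fix N assume "N \<in> null_sets M"
    then show "act a -` N \<inter> space M \<in> null_sets M"
      using eq[OF a] measurable_sets[OF meas[OF a]] by (auto simp: null_sets_def)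
  qed (use assms in auto)
qed

section \<open>Haar measure\<close>

lemma topspace_compact_open_topology: "topspace (compact_open_topology G) = G"
proof -
  \<comment> \<open>For \<open>K = {}\<close> the inclusion is vacuous, so \<open>G\<close> itself
    is subbasic.\<close>
  have "G \<in> {{\<phi>\<in>G. \<phi> ` K \<subseteq> V} | K V. compact K \<and> open V}"
    by (intro CollectI exI[of _ "{}"]) auto
  then show ?thesis
    unfolding compact_open_topology_def topology_generated_by_topspace by blast
qed

text \<open>A continuous map sends one topspace into the other, so continuity of composition and
  inversion already contains closure under them.\<close>

lemma topological_group_closed:
  assumes "locally_compact_topological_group G"
  shows "a \<in> G \<Longrightarrow> inv a \<in> G" "a \<in> G \<Longrightarrow> b \<in> G \<Longrightarrow> a \<circ> b \<in> G"
proof -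
  let ?T = "compact_open_topology G"
  have "continuous_map ?T ?T inv" "continuous_map (prod_topology ?T ?T) ?T (\<lambda>(a, b). a \<circ> b)"
    using assms by (simp_all add: locally_compact_topological_group_def Let_def)
  from this[THEN continuous_map_funspace]
  show "a \<in> G \<Longrightarrow> inv a \<in> G" "a \<in> G \<Longrightarrow> b \<in> G \<Longrightarrow> a \<circ> b \<in> G"
    by (fastforce simp: topspace_compact_open_topology Pi_iff)+
qed

lemma haar_measure_action:
  assumes group: "locally_compact_topological_group G" and haar: "haar_measure G \<mu>"
    and bij: "\<And>a. a \<in> G \<Longrightarrow> bij a"
  shows "measure_preserving_action G act_group \<mu>"
proof (rule measure_preserving_actionI)
  let ?T = "compact_open_topology G"
  have sp: "space \<mu> = G" and sets: "sets \<mu> = sigma_sets G {V. openin ?T V}"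
    using haar by (auto simp: haar_measure_def Let_def)
  fix a assume a: "a \<in> G"
  show "act_group a \<in> measurable \<mu> \<mu>"
  proof (rule measurable_sigma_sets)
    show "sets \<mu> = sigma_sets G {V. openin ?T V}" by (rule sets)
    show "{V. openin ?T V} \<subseteq> Pow G"
      using openin_subset topspace_compact_open_topology by fastforce
    show "act_group a \<in> space \<mu> \<rightarrow> G"
      using a topological_group_closed(2)[OF group] by (auto simp: sp act_group_def)
    fix V assume "V \<in> {V. openin ?T V}"
    then have V: "openin ?T V" by simp
    \<comment> \<open>Left multiplication by \<open>a\<close> is this slice inclusion followed by
      the continuous multiplication, so preimages of the generating open sets are open.\<close>
    have "continuous_map ?T (prod_topology ?T ?T) (\<lambda>h. (a, h))"
      using a by (simp add: continuous_map_pairwise comp_def topspace_compact_open_topology)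
    moreover have "continuous_map (prod_topology ?T ?T) ?T (\<lambda>(a, b). a \<circ> b)"
      using group by (simp add: locally_compact_topological_group_def Let_def)
    ultimately have "continuous_map ?T ?T ((\<lambda>(a, b). a \<circ> b) \<circ> (\<lambda>h. (a, h)))"
      by (rule continuous_map_compose)
    also have "(\<lambda>(a, b). a \<circ> b) \<circ> (\<lambda>h. (a, h)) = act_group a"
      by (simp add: fun_eq_iff act_group_def)
    finally have "openin ?T {h \<in> topspace ?T. act_group a h \<in> V}"
      using V by (rule openin_continuous_map_preimage)
    also have "{h \<in> topspace ?T. act_group a h \<in> V} = act_group a -` V \<inter> space \<mu>"
      by (auto simp: sp topspace_compact_open_topology)
    finally have "openin ?T (act_group a -` V \<inter> space \<mu>)" .
    then show "act_group a -` V \<inter> space \<mu> \<in> sets \<mu>"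
      unfolding sets by (simp add: sigma_sets.Basic)
  qed
  fix B assume "B \<in> sets \<mu>"
  then show "emeasure \<mu> (act_group a ` B) = emeasure \<mu> B"
    using haar a by (simp add: haar_measure_def Let_def act_group_def[abs_def])
qed (use bij topological_group_closed[OF group] in \<open>auto simp: act_group_def comp_assoc\<close>)

section \<open>Volume forms and diffeomorphisms\<close>

lemma chart_inv_simps:
  assumes "is_chart c" "p \<in> fst c"
  shows "chart_inv c (snd c p) = p"
  using assms by (simp add: is_chart_def homeomorphism_def)

lemma smooth_on_imp_continuous_on: "smooth_on S f \<Longrightarrow> continuous_on S f"
  using Ck_on.simps(1) unfolding smooth_on_def by blast

lemma smooth_on_imp_differentiable_on:
  assumes "smooth_on S f"
  shows "f differentiable_on S"
proof -
  have "Ck_on (Suc 0) f S"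
    using assms unfolding smooth_on_def by blast
  then show ?thesis
    by (auto simp: differentiable_on_def intro: differentiable_at_withinI)
qed

text \<open>The image of \<open>B\<close> under the chart is its preimage under the inverse chart,
  which is continuous on an open set.\<close>

lemma borel_chart_image:
  assumes c: "is_chart c" and B: "B \<in> sets borel" "B \<subseteq> fst c"
  shows "snd c ` B \<in> sets borel"
proof -
  let ?U = "snd c ` fst c"
  have U: "open ?U" and cont: "continuous_on ?U (chart_inv c)"
    using c by (auto simp: is_chart_def homeomorphism_def)
  have "snd c ` B = chart_inv c -` B \<inter> ?U"
    using B(2) chart_inv_simps[OF c] by force
  moreover have "chart_inv c \<in> borel_measurable (restrict_space borel ?U)"
    by (rule borel_measurable_continuous_on_restrict[OF cont])
  from measurable_sets[OF this B(1)] have "chart_inv c -` B \<inter> ?U \<in> sets borel"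
    using U by (simp add: space_restrict_space sets_restrict_space_iff)
  ultimately show ?thesis by simp
qed

text \<open>In a chart the measure has the density \<open>\<bar>\<omega>\<bar>\<close>, which
  vanishes nowhere, so its null sets are those of Lebesgue measure. This moves the question to
  Euclidean space.\<close>

lemma volume_form_measure_null_iff:
  fixes A :: "('m::topological_space, 'n::finite) chart set"
  assumes atlas: "smooth_atlas A" and form: "volume_form A \<omega>" and \<nu>: "volume_form_measure A \<omega> \<nu>"
    and c: "c \<in> A" and B: "B \<in> sets borel" "B \<subseteq> fst c"
  shows "emeasure \<nu> B = 0 \<longleftrightarrow> negligible (snd c ` B)"
proof -
  let ?\<omega> = "\<lambda>x. \<omega> c (chart_inv c x)" and ?S = "snd c ` B"
  have chart: "is_chart c"
    using atlas c by (simp add: smooth_atlas_def)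
  have S: "?S \<in> sets borel"
    by (rule borel_chart_image[OF chart B])
  have "continuous_on (snd c ` fst c) ?\<omega>"
    using form c by (auto simp: volume_form_def intro: smooth_on_imp_continuous_on)
  then have "continuous_on ?S ?\<omega>"
    by (rule continuous_on_subset) (use B(2) in auto)
  then have "?\<omega> \<in> borel_measurable (restrict_space borel ?S)"
    by (rule borel_measurable_continuous_on_restrict)
  then have ennreal: "(\<lambda>x. ennreal \<bar>?\<omega> x\<bar>) \<in> borel_measurable (restrict_space borel ?S)"
    by (intro measurable_compose[OF _ measurable_ennreal] borel_measurable_abs)
  have "(\<lambda>x. ennreal \<bar>?\<omega> x\<bar> * indicator ?S x) \<in> borel_measurable borel"
    by (rule borel_measurable_restrict_space_iff_ennreal[THEN iffD1, OF _ ennreal]) (use S in simp)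
  then have meas: "(\<lambda>x. ennreal \<bar>?\<omega> x\<bar> * indicator ?S x) \<in> borel_measurable lborel"
    by (simp only: measurable_lborel2)
  have nz: "?\<omega> x \<noteq> 0" if "x \<in> ?S" for x
  proof -
    obtain p where p: "p \<in> fst c" "x = snd c p"
      using \<open>x \<in> ?S\<close> B(2) by blast
    have "\<omega> c p \<noteq> 0"
      using form c p(1) unfolding volume_form_def by blast
    then show ?thesis
      by (simp add: p chart_inv_simps[OF chart])
  qed
  have "emeasure \<nu> B = (\<integral>\<^sup>+ x\<in>?S. ennreal \<bar>?\<omega> x\<bar> \<partial>lborel)"
    by (rule \<nu>[unfolded volume_form_measure_def, THEN conjunct2, rule_format, OF c B])
  then have "emeasure \<nu> B = 0 \<longleftrightarrow> (AE x in lborel. ennreal \<bar>?\<omega> x\<bar> * indicator ?S x = 0)"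
    using nn_integral_0_iff_AE[OF meas] by simp
  also have "\<dots> \<longleftrightarrow> (AE x in lborel. x \<notin> ?S)"
    by (intro AE_cong) (use nz in \<open>auto simp: indicator_def\<close>)
  also have "\<dots> \<longleftrightarrow> ?S \<in> null_sets lborel"
    using S by (simp add: AE_iff_null_sets)
  \<comment> \<open>\<open>negligible\<close> refers to the completed Lebesgue measure, which has
    the same null sets among Borel sets.\<close>
  also have "\<dots> \<longleftrightarrow> negligible ?S"
    using S by (simp add: negligible_iff_null_sets null_sets_completion_iff)
  finally show ?thesis .
qed

text \<open>Cut the preimage into pieces lying in one chart and mapped into one chart. In
  coordinates each piece is contained in the image of a negligible set under the differentiable map
  representing \<open>inv \<phi>\<close>, and countably many pieces suffice.\<close>

lemma volume_form_measure_diffeo_null: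
  fixes A :: "('m::second_countable_topology, 'n::finite) chart set"
  assumes atlas: "smooth_atlas A" and form: "volume_form A \<omega>" and \<nu>: "volume_form_measure A \<omega> \<nu>"
    and \<phi>: "bij \<phi>" "smooth_map A \<phi>" "smooth_map A (inv \<phi>)"
    and N: "N \<in> null_sets \<nu>"
  shows "\<phi> -` N \<in> null_sets \<nu>"
proof -
  have sets: "sets \<nu> = sets borel"
    using \<nu> by (simp add: volume_form_measure_def)
  have cont: "continuous_on UNIV \<phi>" and cont': "continuous_on UNIV (inv \<phi>)"
    using \<phi> by (simp_all add: smooth_map_def)
  have chart: "is_chart c" if "c \<in> A" for c
    using atlas that by (simp add: smooth_atlas_def)
  have op: "open (fst c)" if "c \<in> A" for c
    using chart[OF that] by (simp add: is_chart_def)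
  have borel_vimage: "\<phi> -` B \<in> sets borel" if "B \<in> sets borel" for B
    using measurable_sets[OF borel_measurable_continuous_onI[OF cont] that] by simp
  have N_borel: "N \<in> sets borel" and N_null: "emeasure \<nu> N = 0"
    using N sets by auto
  define P where "P c d = fst c \<inter> \<phi> -` (fst d \<inter> N)" for c d :: "('m, 'n) chart"
  have P_null: "P c d \<in> null_sets \<nu>" if c: "c \<in> A" and d: "d \<in> A" for c d
  proof -
    \<comment> \<open>\<open>Q\<close> is the image of \<open>P c d\<close> under
      \<open>\<phi>\<close>; it is null as a subset of \<open>N\<close>.\<close>
    define Q where "Q = fst d \<inter> N \<inter> inv \<phi> -` fst c"
    have "open (inv \<phi> -` fst c)"
      using open_vimage[OF op[OF c]] cont' by simp
    then have Q: "Q \<in> sets borel" "Q \<subseteq> fst d"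
      using N_borel op[OF d] by (auto simp: Q_def)
    have P: "P c d \<in> sets borel" "P c d \<subseteq> fst c"
      using borel_vimage[of "fst d \<inter> N"] N_borel op[OF d] op[OF c] by (auto simp: P_def)
    have "emeasure \<nu> Q = 0"
      using emeasure_mono[of Q N \<nu>] N_null N_borel sets by (auto simp: Q_def)
    then have neg: "negligible (snd d ` Q)"
      using volume_form_measure_null_iff[OF atlas form \<nu> d Q] by simp
    have "local_rep (inv \<phi>) d c differentiable_on snd d ` (fst d \<inter> inv \<phi> -` fst c)"
      using \<phi>(3) c d by (auto simp: smooth_map_def intro: smooth_on_imp_differentiable_on)
    then have "local_rep (inv \<phi>) d c differentiable_on snd d ` Q"
      by (rule differentiable_on_subset) (auto simp: Q_def)
    \<comment> \<open>Differentiable maps between Euclidean spaces of equal dimension preserve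
      negligible sets.\<close>
    then have "negligible (local_rep (inv \<phi>) d c ` snd d ` Q)"
      by (intro negligible_differentiable_image_negligible neg) auto
    moreover have "snd c ` P c d \<subseteq> local_rep (inv \<phi>) d c ` snd d ` Q"
    proof safe
      fix p assume p: "p \<in> P c d"
      then have "\<phi> p \<in> Q"
        using \<phi>(1) by (auto simp: P_def Q_def bij_is_inj)
      moreover from this have "local_rep (inv \<phi>) d c (snd d (\<phi> p)) = snd c p"
        using Q(2) \<phi>(1) chart_inv_simps[OF chart[OF d]] by (auto simp: local_rep_def bij_is_inj)
      ultimately show "snd c p \<in> local_rep (inv \<phi>) d c ` snd d ` Q"
        by (metis imageI)
    qed
    ultimately have "negligible (snd c ` P c d)"
      by (rule negligible_subset)
    then show ?thesis
      using volume_form_measure_null_iff[OF atlas form \<nu> c P] P(1) sets by auto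
  qed
  \<comment> \<open>The atlas may be uncountable; these open sets cover the manifold, and second
    countability leaves a countable subcover.\<close>
  define \<U> where "\<U> = (\<lambda>(c, d). fst c \<inter> \<phi> -` fst d) ` (A \<times> A)"
  have "open U" if "U \<in> \<U>" for U
    using that op open_vimage[OF _ cont] by (auto simp: \<U>_def)
  then obtain \<V> where \<V>: "\<V> \<subseteq> \<U>" "countable \<V>" "\<Union>\<V> = \<Union>\<U>"
    using Lindelof[of \<U>] by metis
  have "\<Union>\<U> = UNIV"
  proof -
    have "\<exists>c\<in>A. p \<in> fst c" for p
      using atlas by (auto simp: smooth_atlas_def)
    then show ?thesis
      by (fastforce simp: \<U>_def)
  qed
  then have "\<phi> -` N = (\<Union>U\<in>\<V>. U \<inter> \<phi> -` N)"
    using \<V>(3) by auto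
  also have "\<dots> \<in> null_sets \<nu>"
  proof (rule null_sets_UN'[OF \<V>(2)])
    fix U assume "U \<in> \<V>"
    then obtain c d where "c \<in> A" "d \<in> A" "U = fst c \<inter> \<phi> -` fst d"
      using \<V>(1) by (auto simp: \<U>_def)
    moreover from this have "U \<inter> \<phi> -` N = P c d"
      by (auto simp: P_def)
    ultimately show "U \<inter> \<phi> -` N \<in> null_sets \<nu>"
      using P_null by simp
  qed
  finally show ?thesis .
qed

section \<open>Isometries of the manifold and the four cases\<close>

lemma isometry_group_measurable:
  assumes "sets \<nu> = sets borel" "a \<in> isometry_group A g"
  shows "act_manifold a \<in> measurable \<nu> \<nu>"
proof -
  have "continuous_on UNIV a"
    using assms(2) by (simp add: isometry_group_def smooth_map_def)
  then have "a \<in> borel_measurable borel"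
    by (rule borel_measurable_continuous_onI)
  then show ?thesis
    unfolding act_manifold_def[abs_def] by (subst measurable_cong_sets[OF assms(1) assms(1)])
qed

theorem theorem4:
  fixes A :: "('m::{t2_space, second_countable_topology}, 'n::finite) chart set"
    and g :: "('m, 'n) metric"
    and \<omega> :: "('m, 'n) chart \<Rightarrow> 'm \<Rightarrow> real"
    and G :: "('m \<Rightarrow> 'm) set"
    and \<nu> :: "'m measure"
    and \<mu> :: "('m \<Rightarrow> 'm) measure"
    and x0 :: 'm
    and mode :: convergence_mode
  assumes "riemannian_homogeneous_space A g"
    and "G = isometry_group A g"
    and "locally_compact_topological_group G"
    and "haar_measure G \<mu>"
    and "volume_form A \<omega>"
    and "volume_form_measure A \<omega> \<nu>"
  shows "(invariant_measure G \<nu> \<longrightarrow>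
            (\<forall>w F. volterra_expansion mode G act_manifold \<nu> (orbit_map x0) \<nu> w F \<longrightarrow>
               equivariant G act_manifold \<nu> act_manifold F)) \<and>
         (invariant_measure G \<nu> \<longrightarrow>
            (\<forall>w F. volterra_expansion mode G act_manifold \<nu> id \<mu> w F \<longrightarrow>
               equivariant G act_manifold \<nu> act_group F)) \<and>
         (\<forall>w F. volterra_expansion mode G act_group \<mu> (orbit_map x0) \<nu> w F \<longrightarrow>
            equivariant G act_group \<mu> act_manifold F) \<and>
         (\<forall>w F. volterra_expansion mode G act_group \<mu> id \<mu> w F \<longrightarrow>
            equivariant G act_group \<mu> act_group F)"
proof -
  have bij: "bij a" if "a \<in> G" for a
    using that assms(2) by (simp add: isometry_group_def)
  have atlas: "smooth_atlas A" and trans: "\<And>p q. \<exists>\<phi>\<in>G. \<phi> p = q"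
    using assms(1,2) by (simp_all add: riemannian_homogeneous_space_def)
  have sets: "sets \<nu> = sets borel"
    using assms(6) by (simp add: volume_form_measure_def)
  note closed = topological_group_closed[OF assms(3)]
  have meas: "act_manifold a \<in> measurable \<nu> \<nu>" if "a \<in> G" for a
    using isometry_group_measurable[OF sets] that assms(2) by blast
  have group: "measure_preserving_action G act_group \<mu>"
    using haar_measure_action[OF assms(3,4) bij] .
  have group': "nonsingular_action G act_group \<mu>"
    using group by (rule measure_preserving_action.axioms)
  \<comment> \<open>For the manifold as target: isometries are diffeomorphisms and so respect null
    sets, whichever volume form is chosen.\<close>
  have manifold': "nonsingular_action G act_manifold \<nu>"
  proof
    fix a N assume "a \<in> G" "N \<in> null_sets \<nu>"
    then have "a -` N \<in> null_sets \<nu>"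
      using volume_form_measure_diffeo_null[OF atlas assms(5,6)] assms(2)
      by (simp add: isometry_group_def)
    then show "act_manifold a -` N \<inter> space \<nu> \<in> null_sets \<nu>"
      using sets_eq_imp_space_eq[OF sets] by (simp add: act_manifold_def[abs_def])
  qed (use bij closed meas in \<open>auto simp: act_manifold_def\<close>)
  \<comment> \<open>For the manifold as source, where the change of variables uses the invariance of
    \<open>\<nu>\<close>.\<close>
  have manifold: "measure_preserving_action G act_manifold \<nu>" if "invariant_measure G \<nu>"
    by (rule measure_preserving_actionI)
       (use that bij closed meas in \<open>auto simp: act_manifold_def[abs_def] invariant_measure_def\<close>)
  \<comment> \<open>Transitivity makes the orbit map onto; it intertwines the actions by
    associativity of evaluation.\<close>
  have orbit: "space \<nu> \<subseteq> orbit_map x0 ` G" "orbit_map x0 (a \<circ> h) = act_manifold a (orbit_map x0 h)"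
    for a h :: "'m \<Rightarrow> 'm"
    using trans[of x0] by (auto simp: orbit_map_def act_manifold_def image_iff) metis
  have id: "space \<mu> \<subseteq> id ` G" "id (a \<circ> h) = act_group a (id h)"
    for a h :: "'m \<Rightarrow> 'm"
    using assms(4) by (simp_all add: haar_measure_def Let_def act_group_def)
  note equivariant = measure_preserving_action.volterra_expansion_equivariant
  show ?thesis
    using equivariant[OF manifold manifold' orbit(2,1)] equivariant[OF manifold group' id(2,1)]
      equivariant[OF group manifold' orbit(2,1)] equivariant[OF group group' id(2,1)]
    by blast
qed

end
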